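(* Let $H$ be a real Hilbert space, let $\mathsf{A},\mathsf{B}$ be maximal monotone operators on $H$ with $S:=\mathsf{A}^{-1}(0)\cap\mathsf{B}^{-1}(0)\neq\emptyset$, let $x_0,u\in H$, $(\alpha_n),(\lambda_n)\subset(0,1)$, $(\beta_n),(\mu_n)\subset(0,+\infty)$, and let $(y_n)$ be given by $y_0=x_0$ and $$y_{2n+1}=J^{\mathsf{A}}_{\beta_n}(\alpha_n u+(1-\alpha_n)y_{2n}),\qquad y_{2n+2}=J^{\mathsf{B}}_{\mu_n}(\lambda_n u+(1-\lambda_n)y_{2n+1})\qquad(n\in\mathbb{N}).$$ Assume $y_n\to x\in H$. Put $\mathsf{A}'=\mathsf{A}$, $\mathsf{B}'=\mathsf{B}$ and, for all $n\in\mathbb{N}$, $\widetilde{\alpha}_n=\lambda_n$, $\widetilde{\lambda}_n=\alpha_{n+1}$, $\widetilde{\beta}_n=\beta_n$, $\widetilde{\mu}_n=\mu_n$, and let $(z_n)$ be given by $z_0=\alpha_0u+(1-\alpha_0)y_0$ and $$z_{2n+1}=\widetilde{\alpha}_nu+(1-\widetilde{\alpha}_n)J^{\mathsf{A}'}_{\widetilde{\beta}_n}(z_{2n}),\qquad z_{2n+2}=\widetilde{\lambda}_nu+(1-\widetilde{\lambda}_n)J^{\mathsf{B}'}_{\widetilde{\mu}_n}(z_{2n+1})\qquad(n\in\mathbb{N}).$$ If $\alpha_n\to0$ and $\lambda_n\to0$, then $z_n\to x$. Moreover, given rates of convergence $a,\ell:\mathbb{N}\to\mathbb{N}$ for $\alpha_n\to0$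 and $\lambda_n\to0$, respectively, and $N\in\mathbb{N}$ such that $N\geq\max\{\|u-q\|,\|x_0-q\|,\|q\|\}$ for some $q\in S$, we have that $\|y_n-z_n\|\to0$ with rate of convergence $$\gamma(k):=2\max\{\widetilde{a}(k),\widetilde{\ell}(k)\}+2,\qquad \widetilde{a}(k):=a(2N(k+1)-1),\quad \widetilde{\ell}(k):=\ell(2N(k+1)-1).$$ If $\rho$ is a rate of metastability for $(y_n)$, then $\widetilde{\rho}$ is a rate of metastability for $(z_n)$, where $$\widetilde{\rho}(k,f):=\max\left\{\rho\left(2k+1,\widetilde{f}[\gamma(4k+3)]\right),\gamma(4k+3)\right\}.$$
   Context: $\mathbb{N}=\{0,1,2,\dots\}$; $[n,p]$ denotes $\{m\in\mathbb{N}:n\leq m\leq p\}$ (empty if $p<n$). For $\gamma>0$, $J^{\mathsf{A}}_\gamma=(I+\gamma\mathsf{A})^{-1}$ is the (single-valued) resolvent of the maximal monotone operator $\mathsf{A}$. Convergence in $H$ is norm convergence. For $f:\mathbb{N}\to\mathbb{N}$ and $M\in\mathbb{N}$, $\widetilde{f}[M](m):=f(\max\{m,M\})$. A rate of convergence for a real sequence $a_n\to0$ is $\gamma:\mathbb{N}\to\mathbb{N}$ with $|a_n|\leq\frac1{k+1}$ for all $k$ and all $n\geq\gamma(k)$. A rate of metastability for a sequence $(x_n)$ in $H$ is a functional $\Gamma:\mathbb{N}\times\mathbb{N}^{\mathbb{N}}\to\mathbb{N}$ such that for all $k\in\mathbb{N}$ and $f:\mathbb{N}\to\mathbb{N}$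 there is $n\leq\Gamma(k,f)$ with $\|x_i-x_j\|\leq\frac1{k+1}$ for all $i,j\in[n,f(n)]$. In the degenerate case $N=0$, $2N(k+1)-1$ is read as $0$ (truncated subtraction). *)

theory Defs
  imports "HOL-Analysis.Analysis"
begin

text \<open>Operators on \<open>H\<close> are set-valued maps \<^typ>\<open>'a \<Rightarrow> 'a set\<close>; their domain is
  \<open>{x. A x \<noteq> {}}\<close>.\<close>

definition monotone_operator :: "('a::real_inner \<Rightarrow> 'a set) \<Rightarrow> bool" where
  "monotone_operator A \<longleftrightarrow>
     (\<forall>x y. \<forall>v \<in> A x. \<forall>w \<in> A y. 0 \<le> inner (x - y) (v - w))"

definition maximal_monotone :: "('a::real_inner \<Rightarrow> 'a set) \<Rightarrow> bool" where
  "maximal_monotone A \<longleftrightarrow> monotone_operator A \<and>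
     (\<forall>A'. monotone_operator A' \<longrightarrow> (\<forall>x. A x \<subseteq> A' x) \<longrightarrow> A' = A)"

definition op_inverse :: "('a \<Rightarrow> 'b set) \<Rightarrow> 'b \<Rightarrow> 'a set" where
  "op_inverse A y = {x. y \<in> A x}"

text \<open>The single-valued version of \<open>(I + \<gamma>A)\<inverse>\<close>. For a maximal monotone \<open>A\<close> on a
  Hilbert space and \<open>\<gamma> > 0\<close>, the set \<open>(I + \<gamma>A)\<inverse> x\<close> is a singleton for every \<open>x\<close> (Minty),
  so the definite description denotes its element.\<close>

definition resolvent :: "real \<Rightarrow> ('a::real_inner \<Rightarrow> 'a set) \<Rightarrow> 'a \<Rightarrow> 'a" where
  "resolvent \<gamma> A x = (THE z. z \<in> op_inverse (\<lambda>z. {z + \<gamma> *\<^sub>R w | w. w \<in> A z}) x)"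

definition rate_of_convergence_to_0 :: "(nat \<Rightarrow> real) \<Rightarrow> (nat \<Rightarrow> nat) \<Rightarrow> bool" where
  "rate_of_convergence_to_0 s \<gamma> \<longleftrightarrow> (\<forall>k. \<forall>n \<ge> \<gamma> k. \<bar>s n\<bar> \<le> 1 / (real k + 1))"

definition rate_of_metastability ::
    "(nat \<Rightarrow> 'a::real_normed_vector) \<Rightarrow> (nat \<Rightarrow> (nat \<Rightarrow> nat) \<Rightarrow> nat) \<Rightarrow> bool" where
  "rate_of_metastability s \<Gamma> \<longleftrightarrow>
     (\<forall>k f. \<exists>n \<le> \<Gamma> k f. \<forall>i \<in> {n..f n}. \<forall>j \<in> {n..f n}. norm (s i - s j) \<le> 1 / (real k + 1))"

text \<open>\<open>shift_fun f M\<close> is the function written \<open>f\<close> with a tilde, followed by \<open>[M]\<close>.\<close>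

definition shift_fun :: "(nat \<Rightarrow> nat) \<Rightarrow> nat \<Rightarrow> nat \<Rightarrow> nat" where
  "shift_fun f M m = f (max m M)"

end

theory Submission
  imports Defs
begin

text \<open>By induction \<open>z\<^sub>n = c\<^sub>n u + (1 - c\<^sub>n) y\<^sub>n\<close>, where \<open>c\<close> interleaves
  \<open>\<alpha>\<close> and \<open>lam\<close>; hence \<open>y\<^sub>n - z\<^sub>n = c\<^sub>n (y\<^sub>n - u)\<close>, and it remains to bound \<open>y\<close>.
  The uniform bound \<open>norm (y\<^sub>n - u) \<le> 2 N\<close> follows from nonexpansiveness of the resolvents, which
  fix \<open>q\<close>. The resolvents are total by Minty's theorem. To prove it, minimise \<open>F(w) + \<parallel>w\<parallel>\<^sup>2/2\<close>
  over \<open>H \<times> H\<close>, where \<open>F\<close> is the Fitzpatrick function of the graph: strong convexity gives a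
  minimiser \<open>(p, q)\<close> with quadratic growth around it, which makes \<open>(-q, -p)\<close> monotonically related
  to the graph, and maximality then forces \<open>q = -p\<close>.\<close>

section \<open>Minimisation of a strongly convex function over an epigraph\<close>

text \<open>\<open>C\<close> plays the role of an epigraph, so that a convex function with possibly
  infinite values is handled through real pairs. Strong convexity of the squared norm makes the
  first components of a minimising sequence Cauchy; comparing the minimiser with points on segments
  yields the quadratic growth.\<close>

lemma strongly_convex_minimum:
  fixes C :: "('b::{real_inner, complete_space} \<times> real) set"
  assumes "closed C" "convex C" "C \<noteq> {}"
    and lb: "\<And>w r. (w, r) \<in> C \<Longrightarrow> b \<le> r + (norm w)\<^sup>2 / 2"
  obtains w r where "(w, r) \<in> C"
    and "\<And>w' r'. (w', r') \<in> C \<Longrightarrow>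
      r + (norm w)\<^sup>2 / 2 + (norm (w' - w))\<^sup>2 / 2 \<le> r' + (norm w')\<^sup>2 / 2"
proof -
  define g where "g p = snd p + (norm (fst p))\<^sup>2 / 2" for p :: "'b \<times> real"
  define m where "m = Inf (g ` C)"
  have bdd: "bdd_below (g ` C)"
    using lb by (intro bdd_belowI[of _ b]) (auto simp: g_def)
  have m_le: "m \<le> g p" if "p \<in> C" for p
    unfolding m_def using that bdd by (intro cInf_lower) auto
  \<comment> \<open>An exact identity: \<open>snd\<close> enters linearly, and the squared norm
    loses precisely the quadratic term.\<close>
  have comb: "g ((1 - t) *\<^sub>R p + t *\<^sub>R p') =
      (1 - t) * g p + t * g p' - t * (1 - t) / 2 * (norm (fst p' - fst p))\<^sup>2" for t p p'
    unfolding g_def power2_norm_eq_inner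
    by (simp add: inner_simps inner_commute field_simps)
  have grow: "t * (1 - t) / 2 * (norm (fst p' - fst p))\<^sup>2 \<le> (1 - t) * g p + t * g p' - m"
    if "p \<in> C" "p' \<in> C" "0 \<le> t" "t \<le> 1" for t p p'
  proof -
    have "(1 - t) *\<^sub>R p + t *\<^sub>R p' \<in> C"
      using \<open>convex C\<close> that by (intro convexD) auto
    from m_le[OF this] show ?thesis unfolding comb by simp
  qed
  have "\<exists>p\<in>C. g p < m + inverse (real (Suc n))" for n
    using cInf_lessD[of "g ` C" "m + inverse (real (Suc n))"] \<open>C \<noteq> {}\<close>
    unfolding m_def by auto
  then obtain X where XC: "\<And>n. X n \<in> C" and Xm: "\<And>n. g (X n) < m + inverse (real (Suc n))"
    by metis
  have gX: "(\<lambda>n. g (X n)) \<longlonglongrightarrow> m"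
  proof (rule tendsto_sandwich[OF _ _ tendsto_const])
    show "\<forall>\<^sub>F n in sequentially. m \<le> g (X n)" using m_le XC by simp
    show "\<forall>\<^sub>F n in sequentially. g (X n) \<le> m + inverse (real (Suc n))"
      using Xm by (simp add: less_imp_le)
    show "(\<lambda>n. m + inverse (real (Suc n))) \<longlonglongrightarrow> m"
      using tendsto_add[OF tendsto_const LIMSEQ_inverse_real_of_nat, of m] by simp
  qed
  have "Cauchy (\<lambda>n. fst (X n))"
  proof (rule metric_CauchyI)
    fix e :: real assume "0 < e"
    \<comment> \<open>With \<open>t = 1/2\<close>, \<open>grow\<close> bounds the squared distance
      by four times the sum of the two excesses over \<open>m\<close>; hence the threshold
      \<open>e\<^sup>2 / 8\<close>.\<close>
    then obtain M where M: "inverse (real (Suc M)) < e\<^sup>2 / 8"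
      using reals_Archimedean[of "e\<^sup>2 / 8"] by auto
    have "dist (fst (X i)) (fst (X j)) < e" if "i \<ge> M" "j \<ge> M" for i j
    proof -
      have small: "g (X n) - m < e\<^sup>2 / 8" if "n \<ge> M" for n
      proof -
        have "inverse (real (Suc n)) \<le> inverse (real (Suc M))"
          using that by (intro le_imp_inverse_le) auto
        with Xm[of n] M show ?thesis by linarith
      qed
      have "(norm (fst (X i) - fst (X j)))\<^sup>2 \<le> 4 * (g (X j) - m) + 4 * (g (X i) - m)"
        using grow[OF XC XC, of "1/2" i j] by (simp add: field_simps)
      then have "(norm (fst (X i) - fst (X j)))\<^sup>2 < e\<^sup>2"
        using small[OF that(1)] small[OF that(2)] by (simp add: field_simps)
      then show ?thesis
        using \<open>0 < e\<close> unfolding dist_norm by (meson less_imp_le power2_less_imp_less)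
    qed
    then show "\<exists>M. \<forall>i\<ge>M. \<forall>j\<ge>M. dist (fst (X i)) (fst (X j)) < e" by blast
  qed
  then obtain w where w: "(\<lambda>n. fst (X n)) \<longlonglongrightarrow> w"
    by (meson Cauchy_convergent convergent_def)
  \<comment> \<open>Chosen so that \<open>g (w, r) = m\<close>; the second components converge to
    \<open>r\<close> because \<open>g (X n)\<close> and the first components converge.\<close>
  define r where "r = m - (norm w)\<^sup>2 / 2"
  have "(\<lambda>n. g (X n) - (norm (fst (X n)))\<^sup>2 / 2) \<longlonglongrightarrow> r"
    unfolding r_def by (intro tendsto_intros gX w) simp
  then have "(\<lambda>n. snd (X n)) \<longlonglongrightarrow> r" by (simp add: g_def)
  with w have "(\<lambda>n. (fst (X n), snd (X n))) \<longlonglongrightarrow> (w, r)" by (rule tendsto_Pair)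
  then have wr: "(w, r) \<in> C"
    using \<open>closed C\<close> XC by (auto intro: closed_sequentially)
  have gm: "g (w, r) = m" by (simp add: g_def r_def)
  show ?thesis
  proof (rule that[OF wr])
    fix w' r' assume wr': "(w', r') \<in> C"
    \<comment> \<open>Since \<open>g (w, r) = m\<close>, a factor \<open>t\<close> cancels in
      \<open>grow\<close>; letting \<open>t\<close> decrease to 0 then removes
      \<open>1 - t\<close>.\<close>
    have *: "(1 - t) * ((norm (w' - w))\<^sup>2 / 2) \<le> g (w', r') - m" if "0 < t" "t < 1" for t
    proof -
      have "t * ((1 - t) * ((norm (w' - w))\<^sup>2 / 2)) \<le> t * (g (w', r') - m)"
        using grow[OF wr wr', of t] that by (simp add: gm algebra_simps)
      then show ?thesis using that by simp
    qed
    have "((\<lambda>t. (1 - t) * ((norm (w' - w))\<^sup>2 / 2)) \<longlongrightarrow> (1 - 0) * ((norm (w' - w))\<^sup>2 / 2))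
        (at_right 0)"
      by (intro tendsto_intros)
    moreover have "\<forall>\<^sub>F t in at_right 0. (1 - t) * ((norm (w' - w))\<^sup>2 / 2) \<le> g (w', r') - m"
      unfolding eventually_at_right_field using * by (intro exI[of _ 1]) auto
    ultimately have "(1 - 0) * ((norm (w' - w))\<^sup>2 / 2) \<le> g (w', r') - m"
      by (rule tendsto_upperbound) simp
    then show "r + (norm w)\<^sup>2 / 2 + (norm (w' - w))\<^sup>2 / 2 \<le> r' + (norm w')\<^sup>2 / 2"
      using gm by (simp add: g_def)
  qed
qed

section \<open>Minty's theorem via the Fitzpatrick function\<close>

text \<open>A point \<open>(p, - p)\<close> solves 0 \<in> p + T p for the operator T with graph
  \<open>G\<close>. The formulation with graphs lets \<open>Minty\<close> apply it to a scaled and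
  translated operator.\<close>

lemma maximal_monotone_graph_meets_antidiagonal:
  fixes G :: "('a::{real_inner, complete_space} \<times> 'a) set"
  assumes mono: "\<And>a b c d. (a, b) \<in> G \<Longrightarrow> (c, d) \<in> G \<Longrightarrow> 0 \<le> inner (a - c) (b - d)"
    and maxi: "\<And>p v. (\<And>a b. (a, b) \<in> G \<Longrightarrow> 0 \<le> inner (p - a) (v - b)) \<Longrightarrow> (p, v) \<in> G"
  shows "\<exists>p. (p, - p) \<in> G"
proof -
  \<comment> \<open>The epigraph of the Fitzpatrick function of \<open>G\<close>.\<close>
  define C where "C = (\<Inter>(a, b)\<in>G. {wr. inner (fst wr) (b, a) - inner a b \<le> snd wr})"
  have inC: "((p, v), r) \<in> C \<longleftrightarrow> (\<forall>(a, b)\<in>G. inner p b + inner v a - inner a b \<le> r)" for p v r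
    by (auto simp: C_def)
  have "closed C"
    unfolding C_def by (intro closed_INT ballI) (auto intro!: closed_Collect_le continuous_intros)
  moreover have "convex C"
    unfolding C_def
  proof (intro convex_INT)
    fix ab assume "ab \<in> G"
    obtain a b where ab: "ab = (a, b)" by force
    have "{wr. inner (fst wr) (b, a) - inner a b \<le> snd wr}
        = {wr. inner ((b, a), - 1 :: real) wr \<le> inner a b}"
      by (auto simp: inner_commute inner_prod_def)
    then show "convex (case ab of (a, b) \<Rightarrow> {wr. inner (fst wr) (b, a) - inner a b \<le> snd wr})"
      by (simp add: ab convex_halfspace_le)
  qed
  \<comment> \<open>Monotonicity bounds the Fitzpatrick function on the graph; these are the test
    points for the minimiser below.\<close>
  moreover have graph: "((a, b), inner a b) \<in> C" if "(a, b) \<in> G" for a b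
    unfolding inC
  proof safe
    fix c d assume "(c, d) \<in> G"
    from mono[OF that this] show "inner a d + inner b c - inner c d \<le> inner a b"
      by (simp add: inner_simps inner_commute)
  qed
  \<comment> \<open>For empty \<open>G\<close> the premise of \<open>maxi\<close> would be vacuous
    and put every pair into \<open>G\<close>.\<close>
  moreover have "G \<noteq> {}" using maxi by blast
  ultimately have C: "closed C" "convex C" "C \<noteq> {}" by auto
  \<comment> \<open>The Fitzpatrick function dominates \<open>inner p v\<close>: otherwise
    \<open>(p, v)\<close> is strictly monotonically related to all of \<open>G\<close>, hence lies
    in \<open>G\<close>, and comparison with itself is contradictory. Adding half the squared norm
    completes a square.\<close>
  have nonneg: "0 \<le> r + (norm w)\<^sup>2 / 2" if "(w, r) \<in> C" for w r
  proof -
    obtain p v where pv: "w = (p, v)" by force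
    have le: "inner p v \<le> r"
    proof (rule ccontr)
      assume "\<not> inner p v \<le> r"
      moreover have rel: "inner p v - r \<le> inner (p - a) (v - b)" if "(a, b) \<in> G" for a b
        using \<open>(w, r) \<in> C\<close> that unfolding pv inC by (force simp: inner_simps inner_commute)
      ultimately have "(p, v) \<in> G" by (intro maxi) force
      from rel[OF this] \<open>\<not> inner p v \<le> r\<close> show False by simp
    qed
    have "0 \<le> (norm (p + v))\<^sup>2 / 2" by simp
    also have "\<dots> = inner p v + (norm w)\<^sup>2 / 2"
      by (simp add: pv power2_norm_eq_inner inner_simps inner_commute field_simps)
    finally show ?thesis using le by simp
  qed
  obtain w r where wr: "(w, r) \<in> C"
    and min: "\<And>w' r'. (w', r') \<in> C \<Longrightarrow>
      r + (norm w)\<^sup>2 / 2 + (norm (w' - w))\<^sup>2 / 2 \<le> r' + (norm w')\<^sup>2 / 2"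
    using strongly_convex_minimum[OF C nonneg] by metis
  obtain p q where pq: "w = (p, q)" by force
  \<comment> \<open>The growth inequality at a graph point, with the nonnegative minimal value
    dropped and the norms expanded.\<close>
  have rel: "(norm (p + q))\<^sup>2 / 2 \<le> inner (- q - a) (- p - b)" if "(a, b) \<in> G" for a b
  proof -
    have "r + (norm w)\<^sup>2 / 2 + (norm ((a, b) - w))\<^sup>2 / 2 \<le> inner a b + (norm (a, b))\<^sup>2 / 2"
      by (rule min[OF graph[OF that]])
    then have "(norm ((a, b) - w))\<^sup>2 / 2 \<le> inner a b + (norm (a, b))\<^sup>2 / 2"
      using nonneg[OF wr] by linarith
    moreover have "(norm ((a, b) - w))\<^sup>2 = (norm (a, b))\<^sup>2 - 2 * inner p a - 2 * inner q b
        + inner p p + inner q q"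
      unfolding pq power2_norm_eq_inner by (simp add: inner_simps inner_commute)
    moreover have "(norm (p + q))\<^sup>2 = inner p p + inner q q + 2 * inner p q"
      unfolding power2_norm_eq_inner by (simp add: inner_simps inner_commute)
    moreover have "inner (- q - a) (- p - b) = inner p q + inner q b + inner p a + inner a b"
      by (simp add: inner_simps inner_commute)
    ultimately show ?thesis by linarith
  qed
  have mem: "(- q, - p) \<in> G"
  proof (rule maxi)
    fix a b assume "(a, b) \<in> G"
    have "0 \<le> (norm (p + q))\<^sup>2 / 2" by simp
    also have "\<dots> \<le> inner (- q - a) (- p - b)" by (rule rel) fact
    finally show "0 \<le> inner (- q - a) (- p - b)" .
  qed
  \<comment> \<open>At the graph point \<open>(- q, - p)\<close> itself the right-hand side of
    \<open>rel\<close> vanishes.\<close>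
  from rel[OF this] have "p + q = 0" by simp
  then have "- q = p" by (simp add: add_eq_0_iff2)
  with mem show ?thesis by metis
qed

text \<open>Adding the single pair \<open>(p, v)\<close> to the graph keeps it monotone, so by
  maximality the pair was already there.\<close>

lemma maximal_monotoneD:
  assumes "maximal_monotone A"
    and "\<And>a b. b \<in> A a \<Longrightarrow> 0 \<le> inner (p - a) (v - b)"
  shows "v \<in> A p"
proof -
  let ?A = "A(p := insert v (A p))"
  have mono: "monotone_operator A" using assms(1) by (simp add: maximal_monotone_def)
  have "0 \<le> inner (a - p) (b - v)" if "b \<in> A a" for a b
    using assms(2)[OF that] by (simp add: inner_simps)
  with mono assms(2) have "monotone_operator ?A"
    unfolding monotone_operator_def by (auto split: if_splits)
  moreover have "\<forall>x. A x \<subseteq> ?A x" by auto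
  ultimately have "?A = A" using assms(1) by (simp add: maximal_monotone_def)
  then have "?A p = A p" by simp
  then show ?thesis by auto
qed

text \<open>\<open>?G\<close> is the graph of \<gamma> A - x, which inherits monotonicity and
  maximality from \<open>A\<close>; an antidiagonal point of it is the required solution.\<close>

theorem Minty:
  fixes A :: "'a::{real_inner, complete_space} \<Rightarrow> 'a set"
  assumes A: "maximal_monotone A" and "\<gamma> > 0"
  shows "\<exists>p v. v \<in> A p \<and> p + \<gamma> *\<^sub>R v = x"
proof -
  let ?G = "{(p, \<gamma> *\<^sub>R v - x) | p v. v \<in> A p}"
  have "\<exists>p. (p, - p) \<in> ?G"
  proof (rule maximal_monotone_graph_meets_antidiagonal)
    fix a b c d assume "(a, b) \<in> ?G" "(c, d) \<in> ?G"
    then obtain v w where vw: "v \<in> A a" "b = \<gamma> *\<^sub>R v - x" "w \<in> A c" "d = \<gamma> *\<^sub>R w - x" by blast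
    have "b - d = \<gamma> *\<^sub>R (v - w)" unfolding vw by (simp add: algebra_simps)
    moreover have "0 \<le> inner (a - c) (v - w)"
      using A vw unfolding maximal_monotone_def monotone_operator_def by blast
    ultimately show "0 \<le> inner (a - c) (b - d)" using \<open>\<gamma> > 0\<close> by simp
  next
    fix p v assume rel: "\<And>a b. (a, b) \<in> ?G \<Longrightarrow> 0 \<le> inner (p - a) (v - b)"
    have "(1 / \<gamma>) *\<^sub>R (v + x) \<in> A p"
    proof (rule maximal_monotoneD[OF A])
      fix a b assume "b \<in> A a"
      then have "0 \<le> inner (p - a) (v - (\<gamma> *\<^sub>R b - x))" by (intro rel) blast
      moreover have "(1 / \<gamma>) *\<^sub>R (v + x) - b = (1 / \<gamma>) *\<^sub>R (v - (\<gamma> *\<^sub>R b - x))"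
        using \<open>\<gamma> > 0\<close> by (simp add: algebra_simps)
      ultimately show "0 \<le> inner (p - a) ((1 / \<gamma>) *\<^sub>R (v + x) - b)" using \<open>\<gamma> > 0\<close> by simp
    qed
    moreover have "v = \<gamma> *\<^sub>R ((1 / \<gamma>) *\<^sub>R (v + x)) - x" using \<open>\<gamma> > 0\<close> by simp
    ultimately show "(p, v) \<in> ?G" by blast
  qed
  then obtain p v where "v \<in> A p" "- p = \<gamma> *\<^sub>R v - x" by blast
  then show ?thesis by (intro exI[of _ p] exI[of _ v]) (simp add: algebra_simps)
qed

section \<open>Resolvents of monotone operators\<close>

text \<open>Monotonicity followed by Cauchy-Schwarz. The case of a zero right-hand side gives
  uniqueness in \<open>resolvent_eqI\<close>.\<close>

lemma monotone_operator_resolvent_nonexpansive: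
  assumes "monotone_operator A" "\<gamma> > 0" "v \<in> A p" "w \<in> A q"
  shows "norm (p - q) \<le> norm ((p + \<gamma> *\<^sub>R v) - (q + \<gamma> *\<^sub>R w))"
proof -
  have "0 \<le> inner (p - q) (v - w)" using assms unfolding monotone_operator_def by blast
  then have "0 \<le> \<gamma> * inner (p - q) (v - w)" using \<open>\<gamma> > 0\<close> by simp
  then have "(norm (p - q))\<^sup>2 \<le> inner (p - q) ((p + \<gamma> *\<^sub>R v) - (q + \<gamma> *\<^sub>R w))"
    by (simp add: power2_norm_eq_inner inner_simps algebra_simps)
  also have "\<dots> \<le> norm (p - q) * norm ((p + \<gamma> *\<^sub>R v) - (q + \<gamma> *\<^sub>R w))"
    by (rule norm_cauchy_schwarz)
  finally show ?thesis
    by (cases "p = q") (simp_all add: power2_eq_square)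
qed

lemma resolvent_eqI:
  assumes "monotone_operator A" "\<gamma> > 0" "v \<in> A p"
  shows "resolvent \<gamma> A (p + \<gamma> *\<^sub>R v) = p"
  unfolding resolvent_def
proof (rule the_equality)
  show "p \<in> op_inverse (\<lambda>z. {z + \<gamma> *\<^sub>R w |w. w \<in> A z}) (p + \<gamma> *\<^sub>R v)"
    using assms(3) by (auto simp: op_inverse_def)
next
  fix z assume "z \<in> op_inverse (\<lambda>z. {z + \<gamma> *\<^sub>R w |w. w \<in> A z}) (p + \<gamma> *\<^sub>R v)"
  then obtain w where "w \<in> A z" "p + \<gamma> *\<^sub>R v = z + \<gamma> *\<^sub>R w" by (auto simp: op_inverse_def)
  with monotone_operator_resolvent_nonexpansive[OF assms(1,2) this(1) assms(3)] show "z = p" by simp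
qed

text \<open>A zero satisfies \<open>q = q + \<gamma> *\<^sub>R 0\<close>, so nonexpansiveness
  compares \<open>x\<close> with \<open>q\<close> itself; \<open>Minty\<close> ensures that the
  definite description denotes at every \<open>x\<close>.\<close>

lemma resolvent_dist_zero_le:
  fixes A :: "'a::{real_inner, complete_space} \<Rightarrow> 'a set"
  assumes A: "maximal_monotone A" and "\<gamma> > 0" and q: "q \<in> op_inverse A 0"
  shows "norm (resolvent \<gamma> A x - q) \<le> norm (x - q)"
proof -
  obtain p v where "v \<in> A p" "x = p + \<gamma> *\<^sub>R v" using Minty[OF A \<open>\<gamma> > 0\<close>] by metis
  moreover have "monotone_operator A" using A by (simp add: maximal_monotone_def)
  ultimately show ?thesis
    using monotone_operator_resolvent_nonexpansive[of A \<gamma> v p 0 q] resolvent_eqI[of A \<gamma> v p]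
      \<open>\<gamma> > 0\<close> q
    by (simp add: op_inverse_def)
qed

section \<open>Balls, parity induction, and rates of convergence and metastability\<close>

lemma norm_convex_comb_diff_le:
  fixes u y q :: "'a::real_normed_vector"
  assumes "0 \<le> t" "t \<le> 1" "norm (u - q) \<le> K" "norm (y - q) \<le> K"
  shows "norm (t *\<^sub>R u + (1 - t) *\<^sub>R y - q) \<le> K"
proof -
  have "t *\<^sub>R u + (1 - t) *\<^sub>R y \<in> cball q K"
    using assms by (intro convexD[OF convex_cball]) (auto simp: dist_norm norm_minus_commute)
  then show ?thesis by (simp add: dist_norm norm_minus_commute)
qed

lemma nat_parity_induct [case_names zero odd even]:
  assumes "P 0" "\<And>m. P (2 * m) \<Longrightarrow> P (2 * m + 1)" "\<And>m. P (2 * m + 1) \<Longrightarrow> P (2 * m + 2)"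
  shows "P (n::nat)"
proof (induction n)
  case (Suc n)
  then show ?case
  proof (cases "even n")
    case True
    with Suc assms(2) show ?thesis by (auto elim!: evenE)
  next
    case False
    with Suc assms(3) show ?thesis by (auto elim!: oddE)
  qed
qed (rule assms(1))

lemma rate_of_convergence_to_0_tendsto:
  assumes "rate_of_convergence_to_0 s \<gamma>"
  shows "s \<longlonglongrightarrow> 0"
proof (rule LIMSEQ_I)
  fix e :: real assume "0 < e"
  then obtain k where "inverse (real (Suc k)) < e" using reals_Archimedean by blast
  then have "norm (s n - 0) < e" if "n \<ge> \<gamma> k" for n
    using assms that unfolding rate_of_convergence_to_0_def
    by (smt (verit) diff_zero inverse_eq_divide of_nat_Suc real_norm_def)
  then show "\<exists>M. \<forall>n\<ge>M. norm (s n - 0) < e" by blast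
qed

text \<open>The error budget is 1/(2k+2) for \<open>y\<close> plus twice 1/(4k+4) for passing
  between \<open>y\<close> and \<open>z\<close>, which explains the arguments \<open>2*k+1\<close>
  and \<open>4*k+3\<close>.\<close>

lemma rate_of_metastability_transfer:
  assumes diff: "rate_of_convergence_to_0 (\<lambda>n. norm (y n - z n)) \<gamma>"
    and meta: "rate_of_metastability y \<rho>"
  shows "rate_of_metastability z
    (\<lambda>k f. max (\<rho> (2*k+1) (shift_fun f (\<gamma> (4*k+3)))) (\<gamma> (4*k+3)))"
  unfolding rate_of_metastability_def
proof (intro allI)
  fix k f
  let ?M = "\<gamma> (4*k+3)"
  \<comment> \<open>The shifted function makes \<open>y\<close> stable on
    \<open>{n..f (max n ?M)}\<close>. This contains the interval starting at the later witness
    \<open>max n ?M\<close>, where \<open>y\<close> and \<open>z\<close> are also close.\<close>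
  obtain n where n: "n \<le> \<rho> (2*k+1) (shift_fun f ?M)"
    and y: "\<And>i j. i \<in> {n..f (max n ?M)} \<Longrightarrow> j \<in> {n..f (max n ?M)} \<Longrightarrow>
      norm (y i - y j) \<le> 1 / (2 * real k + 2)"
  proof -
    have "\<exists>n\<le>\<rho> (2*k+1) (shift_fun f ?M). \<forall>i\<in>{n..shift_fun f ?M n}. \<forall>j\<in>{n..shift_fun f ?M n}.
        norm (y i - y j) \<le> 1 / (real (2*k+1) + 1)"
      using meta unfolding rate_of_metastability_def by blast
    then show ?thesis using that by (auto simp: shift_fun_def add.commute)
  qed
  have yz: "norm (y i - z i) \<le> 1 / (4 * real k + 4)" if "i \<ge> ?M" for i
  proof -
    have "\<bar>norm (y i - z i)\<bar> \<le> 1 / (real (4*k+3) + 1)"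
      using diff that unfolding rate_of_convergence_to_0_def by blast
    then show ?thesis by (simp add: add.commute)
  qed
  have "norm (z i - z j) \<le> 1 / (real k + 1)"
    if ij: "i \<in> {max n ?M..f (max n ?M)}" "j \<in> {max n ?M..f (max n ?M)}" for i j
  proof -
    have "z i - z j = (y i - y j) - (y i - z i) + (y j - z j)" by simp
    then have "norm (z i - z j) \<le> norm (y i - y j) + norm (y i - z i) + norm (y j - z j)"
      by (metis add_right_mono norm_triangle_ineq norm_triangle_ineq4 order_trans)
    also have "\<dots> \<le> 1 / (2 * real k + 2) + 1 / (4 * real k + 4) + 1 / (4 * real k + 4)"
      using ij by (intro add_mono y yz) auto
    also have "\<dots> = 1 / (real k + 1)" by (simp add: divide_simps) (simp add: algebra_simps)
    finally show ?thesis .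
  qed
  then show "\<exists>n\<le>max (\<rho> (2*k+1) (shift_fun f ?M)) ?M.
      \<forall>i\<in>{n..f n}. \<forall>j\<in>{n..f n}. norm (z i - z j) \<le> 1 / (real k + 1)"
    using n by (intro exI[of _ "max n ?M"]) auto
qed

section \<open>Comparison of the two iterations\<close>

theorem proposition3p10:
  fixes A B A' B' :: "'a::{real_inner, complete_space} \<Rightarrow> 'a set"
    and x0 u x :: 'a
    and \<alpha> lam \<beta> \<mu> \<alpha>t lamt \<beta>t \<mu>t :: "nat \<Rightarrow> real"
    and y z :: "nat \<Rightarrow> 'a"
  assumes A: "maximal_monotone A" and B: "maximal_monotone B"
    and S: "op_inverse A 0 \<inter> op_inverse B 0 \<noteq> {}"
    and \<alpha>: "\<And>n. \<alpha> n \<in> {0<..<1}" and lam: "\<And>n. lam n \<in> {0<..<1}"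
    and \<beta>: "\<And>n. \<beta> n > 0" and \<mu>: "\<And>n. \<mu> n > 0"
    and y_0: "y 0 = x0"
    and y_odd: "\<And>n. y (2*n+1) = resolvent (\<beta> n) A (\<alpha> n *\<^sub>R u + (1 - \<alpha> n) *\<^sub>R y (2*n))"
    and y_even: "\<And>n. y (2*n+2) = resolvent (\<mu> n) B (lam n *\<^sub>R u + (1 - lam n) *\<^sub>R y (2*n+1))"
    and y_lim: "y \<longlonglongrightarrow> x"
    and A': "A' = A" and B': "B' = B"
    and \<alpha>t: "\<And>n. \<alpha>t n = lam n" and lamt: "\<And>n. lamt n = \<alpha> (n+1)"
    and \<beta>t: "\<And>n. \<beta>t n = \<beta> n" and \<mu>t: "\<And>n. \<mu>t n = \<mu> n"
    and z_0: "z 0 = \<alpha> 0 *\<^sub>R u + (1 - \<alpha> 0) *\<^sub>R y 0"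
    and z_odd: "\<And>n. z (2*n+1) = \<alpha>t n *\<^sub>R u + (1 - \<alpha>t n) *\<^sub>R resolvent (\<beta>t n) A' (z (2*n))"
    and z_even: "\<And>n. z (2*n+2) = lamt n *\<^sub>R u + (1 - lamt n) *\<^sub>R resolvent (\<mu>t n) B' (z (2*n+1))"
  shows "(\<alpha> \<longlonglongrightarrow> 0 \<longrightarrow> lam \<longlonglongrightarrow> 0 \<longrightarrow> z \<longlonglongrightarrow> x) \<and>
    (\<forall>a l (N::nat).
       rate_of_convergence_to_0 \<alpha> a \<longrightarrow> rate_of_convergence_to_0 lam l \<longrightarrow>
       (\<exists>q \<in> op_inverse A 0 \<inter> op_inverse B 0.
          real N \<ge> Max {norm (u - q), norm (x0 - q), norm q}) \<longrightarrow>
       (let a_t = (\<lambda>k. a (2*N*(k+1) - 1));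
            l_t = (\<lambda>k. l (2*N*(k+1) - 1));
            \<gamma> = (\<lambda>k. 2 * max (a_t k) (l_t k) + 2)
        in (\<lambda>n. norm (y n - z n)) \<longlonglongrightarrow> 0 \<and>
           rate_of_convergence_to_0 (\<lambda>n. norm (y n - z n)) \<gamma> \<and>
           (\<forall>\<rho>. rate_of_metastability y \<rho> \<longrightarrow>
              rate_of_metastability z
                (\<lambda>k f. max (\<rho> (2*k+1) (shift_fun f (\<gamma> (4*k+3)))) (\<gamma> (4*k+3))))))"
proof -
  define c where "c n = (if even n then \<alpha> (n div 2) else lam (n div 2))" for n
  have c_even: "c (2*m) = \<alpha> m" and c_odd: "c (2*m+1) = lam m" for m
    by (simp_all add: c_def)
  have c01: "0 \<le> c n" "c n \<le> 1" for n
    using \<alpha>[of "n div 2"] lam[of "n div 2"] by (auto simp: c_def)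
  have z: "z n = c n *\<^sub>R u + (1 - c n) *\<^sub>R y n" for n
  proof (induction n rule: nat_parity_induct)
    case zero
    then show ?case by (simp add: z_0 c_def)
  next
    case (odd m)
    \<comment> \<open>By the induction hypothesis, \<open>z (2*m)\<close> is exactly the argument of
      the resolvent defining \<open>y (2*m+1)\<close>.\<close>
    then have "resolvent (\<beta>t m) A' (z (2*m)) = y (2*m+1)"
      unfolding y_odd A' \<beta>t c_even by simp
    then show ?case unfolding z_odd \<alpha>t c_odd by simp
  next
    case (even m)
    then have "resolvent (\<mu>t m) B' (z (2*m+1)) = y (2*m+2)"
      unfolding y_even B' \<mu>t c_odd by simp
    \<comment> \<open>This matches the index shift in \<open>lamt\<close>: the weight at
      \<open>2*m+2\<close> belongs to the next round.\<close>
    moreover have "c (2*m+2) = \<alpha> (m+1)" using c_even[of "m+1"] by simp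
    ultimately show ?case unfolding z_even lamt by simp
  qed
  have yz: "norm (y n - z n) = c n * norm (y n - u)" for n
  proof -
    have "y n - z n = c n *\<^sub>R (y n - u)" unfolding z by (simp add: algebra_simps)
    then show ?thesis using c01[of n] by simp
  qed
  have lim: "z \<longlonglongrightarrow> x" if "\<alpha> \<longlonglongrightarrow> 0" "lam \<longlonglongrightarrow> 0"
  proof -
    have half: "filterlim (\<lambda>n::nat. n div 2) sequentially sequentially"
      by (rule filterlim_at_top_div_const_nat) simp
    have "c \<longlonglongrightarrow> 0"
    proof (rule tendsto_sandwich[OF _ _ tendsto_const])
      show "\<forall>\<^sub>F n in sequentially. 0 \<le> c n" using c01 by simp
      \<comment> \<open>By positivity the sum dominates \<open>c n\<close> for either
        parity.\<close>
      show "\<forall>\<^sub>F n in sequentially. c n \<le> \<alpha> (n div 2) + lam (n div 2)"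
        using \<alpha> lam by (auto simp: c_def less_imp_le)
      show "(\<lambda>n. \<alpha> (n div 2) + lam (n div 2)) \<longlonglongrightarrow> 0"
        using tendsto_add[OF filterlim_compose[OF that(1) half] filterlim_compose[OF that(2) half]]
        by simp
    qed
    then have "(\<lambda>n. c n *\<^sub>R u + (1 - c n) *\<^sub>R y n) \<longlonglongrightarrow> 0 *\<^sub>R u + (1 - 0) *\<^sub>R x"
      by (intro tendsto_intros y_lim)
    moreover have "z = (\<lambda>n. c n *\<^sub>R u + (1 - c n) *\<^sub>R y n)" by (rule ext) (rule z)
    ultimately show ?thesis by simp
  qed
  have rate: "rate_of_convergence_to_0 (\<lambda>n. norm (y n - z n))
      (\<lambda>k. 2 * max (a (2*N*(k+1) - 1)) (l (2*N*(k+1) - 1)) + 2)"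
    if a: "rate_of_convergence_to_0 \<alpha> a" and l: "rate_of_convergence_to_0 lam l"
      and q: "q \<in> op_inverse A 0 \<inter> op_inverse B 0"
      and N: "real N \<ge> Max {norm (u - q), norm (x0 - q), norm q}" for a l q and N :: nat
  proof -
    have Nu: "norm (u - q) \<le> N" and Nx: "norm (x0 - q) \<le> N" using N by auto
    have yq: "norm (y n - q) \<le> N" for n
    proof (induction n rule: nat_parity_induct)
      case zero
      then show ?case by (simp add: y_0 Nx)
    next
      case (odd m)
      with \<alpha>[of m] Nu q show ?case unfolding y_odd
        by (intro order_trans[OF resolvent_dist_zero_le[OF A \<beta>] norm_convex_comb_diff_le]) auto
    next
      case (even m)
      with lam[of m] Nu q show ?case unfolding y_even
        by (intro order_trans[OF resolvent_dist_zero_le[OF B \<mu>] norm_convex_comb_diff_le]) auto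
    qed
    \<comment> \<open>Both \<open>y n\<close> and \<open>u\<close> lie within \<open>N\<close> of
      \<open>q\<close>; this is the source of \<open>2*N\<close> in the rate.\<close>
    have yu: "norm (y n - u) \<le> 2 * N" for n
      using norm_triangle_ineq4[of "y n - q" "u - q"] yq[of n] Nu by simp
    show ?thesis
      unfolding rate_of_convergence_to_0_def
    proof (intro allI impI)
      fix k n
      let ?K = "2*N*(k+1) - 1"
      assume n: "2 * max (a ?K) (l ?K) + 2 \<le> n"
      have cn: "c n \<le> 1 / (real ?K + 1)"
      proof -
        \<comment> \<open>\<open>c n\<close> reads its sequence at index \<open>n div 2\<close>;
          hence the doubled maximum in the rate, valid for both parities.\<close>
        have "a ?K \<le> n div 2" "l ?K \<le> n div 2" using n by linarith+
        then have "\<bar>\<alpha> (n div 2)\<bar> \<le> 1 / (real ?K + 1)" "\<bar>lam (n div 2)\<bar> \<le> 1 / (real ?K + 1)"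
          using a l unfolding rate_of_convergence_to_0_def by blast+
        then show ?thesis unfolding c_def by (auto dest: abs_le_D1)
      qed
      have "c n * (2 * N) \<le> 1 / (real k + 1)"
      \<comment> \<open>For positive \<open>N\<close> the subtraction in \<open>?K\<close> is exact.
        For \<open>N = 0\<close> it truncates to 0, but then the left-hand side is 0.\<close>
      proof (cases "N = 0")
        case False
        then have "real ?K + 1 = 2 * N * (real k + 1)" by (simp add: of_nat_diff algebra_simps)
        with cn have "c n \<le> 1 / (2 * N * (real k + 1))" by (simp only:)
        then have "c n * (2 * N) \<le> 1 / (2 * N * (real k + 1)) * (2 * N)"
          by (rule mult_right_mono) simp
        also have "\<dots> = 1 / (real k + 1)" using False by simp
        finally show ?thesis .
      qed simp
      moreover have "c n * norm (y n - u) \<le> c n * (2 * N)"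
        by (intro mult_left_mono yu c01)
      ultimately show "\<bar>norm (y n - z n)\<bar> \<le> 1 / (real k + 1)"
        unfolding abs_norm_cancel unfolding yz by linarith
    qed
  qed
  show ?thesis
    unfolding Let_def
  proof (intro conjI allI impI)
    show "z \<longlonglongrightarrow> x" if "\<alpha> \<longlonglongrightarrow> 0" "lam \<longlonglongrightarrow> 0"
      using that by (rule lim)
  next
    fix a l and N :: nat
    assume "rate_of_convergence_to_0 \<alpha> a" "rate_of_convergence_to_0 lam l"
      "\<exists>q\<in>op_inverse A 0 \<inter> op_inverse B 0. real N \<ge> Max {norm (u - q), norm (x0 - q), norm q}"
    then show *: "rate_of_convergence_to_0 (\<lambda>n. norm (y n - z n))
        (\<lambda>k. 2 * max (a (2*N*(k+1) - 1)) (l (2*N*(k+1) - 1)) + 2)"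
      using rate by blast
    then show "(\<lambda>n. norm (y n - z n)) \<longlonglongrightarrow> 0"
      by (rule rate_of_convergence_to_0_tendsto)
    show "rate_of_metastability z
        (\<lambda>k f. max (\<rho> (2*k+1) (shift_fun f
            (2 * max (a (2*N*(4*k+3+1) - 1)) (l (2*N*(4*k+3+1) - 1)) + 2)))
          (2 * max (a (2*N*(4*k+3+1) - 1)) (l (2*N*(4*k+3+1) - 1)) + 2))"
      if "rate_of_metastability y \<rho>" for \<rho>
      using rate_of_metastability_transfer[OF * that] .
  qed
qed

end
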